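(* Let $G$ be a graph with $n$ vertices and let $M=M[IAS(G)]$ be its isotropic matroid. Every graph falls under precisely one of the following four cases. \begin{enumerate} \item If $n=0$ then $\kappa^{\ast}(M)=0$ and $\tau(M)=\infty$. \item If $n=1$ or $G$ is disconnected, then $\tau(M)=\kappa^{\ast}(M)=1$. \item If $n>1$, $G$ is connected, and $G$ has a pendant vertex or a pair of twin vertices, then $\tau(M)=\kappa^{\ast}(M)=2$. \item If $n>1$, $G$ is connected, and $G$ has neither a pendant vertex nor a pair of twin vertices, then $\tau(M)=\kappa^{\ast}(M)=3$. \end{enumerate}
   Context: A graph is a finite looped simple graph: each edge joins one or two vertices, and no two edges have the same ends; an edge on one vertex is a loop. "Adjacent"/"neighbor" refer only to non-loop edges; $N_G(v)=\{w\neq v\mid vw\in E(G)\}$, and $n=|V(G)|$. The adjacency matrix $A(G)$ is the $V(G)\times V(G)$ matrix over $GF(2)$ with diagonal entry $1$ at $v$ iff $v$ is looped and off-diagonal entry $1$ at $(v,w)$ iff $v,w$ are neighbors. The isotropic matroid $M[IAS(G)]$ is the binary matroid represented by the $V(G)\times 3V(G)$ matrix $IAS(G)=(I\;A(G)\;A(G)+I)$; its ground set $W(G)$ has $3n$ elements $\phi_G(v),\chi_G(v),\psi_G(v)$ ($v\in V(G)$), corresponding to the $v$ columns of $I$, $A(G)$, $A(G)+I$. Distinct vertices $v,w$ are twins if $N_G(v)-\{w\}=N_G(w)-\{v\}$; $v$ is pendant on $w$ if $N_G(v)=\{w\}$. For a matroid $M$ with ground set $W$ and rank function $r$, $\lambda(S)=r(S)+r(W-S)-r(M)$.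 A subset $S\subseteq W$ is an ordinary $k$-separation if $\lambda(S)<k$ and $|S|,|W-S|\ge k$; a cyclic $k$-separation if $\lambda(S)<k$ and both $S$ and $W-S$ are dependent. $\tau(M)$ is the least $k$ such that $M$ has an ordinary $k$-separation ($\infty$ if none); $\kappa^{\ast}(M)=\min(\{k\mid M\text{ has a cyclic }k\text{-separation}\}\cup\{|W|-r(M)\})$. *)

theory Defs
  imports Complex_Main "HOL-Library.Z2" "HOL-Library.Extended_Nat" "HOL-Library.Function_Algebras"
begin

section \<open>Looped simple graphs\<close>

record 'v graph =
  verts :: "'v set"
  edges :: "'v set set"

text \<open>An edge is the set of its ends, so a loop at \<open>v\<close> is the singleton \<open>{v}\<close> and
  parallel edges cannot occur.\<close>

definition looped_simple_graph :: "'v graph \<Rightarrow> bool" where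
  "looped_simple_graph G \<longleftrightarrow>
     finite (verts G) \<and> (\<forall>e\<in>edges G. e \<subseteq> verts G \<and> card e \<in> {1, 2})"

definition looped :: "'v graph \<Rightarrow> 'v \<Rightarrow> bool" where
  "looped G v \<longleftrightarrow> {v} \<in> edges G"

definition neighbors :: "'v graph \<Rightarrow> 'v \<Rightarrow> 'v set" where
  "neighbors G v = {w. w \<noteq> v \<and> {v, w} \<in> edges G}"

definition twins :: "'v graph \<Rightarrow> 'v \<Rightarrow> 'v \<Rightarrow> bool" where
  "twins G v w \<longleftrightarrow> v \<in> verts G \<and> w \<in> verts G \<and> v \<noteq> w \<and>
     neighbors G v - {w} = neighbors G w - {v}"

definition pendant_on :: "'v graph \<Rightarrow> 'v \<Rightarrow> 'v \<Rightarrow> bool" where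
  "pendant_on G v w \<longleftrightarrow> v \<in> verts G \<and> w \<in> verts G \<and> neighbors G v = {w}"

text \<open>Any two vertices are joined by a walk; the empty graph is vacuously connected.\<close>

definition connected_graph :: "'v graph \<Rightarrow> bool" where
  "connected_graph G \<longleftrightarrow>
     (\<forall>u\<in>verts G. \<forall>v\<in>verts G. (\<lambda>x y. y \<in> neighbors G x)\<^sup>*\<^sup>* u v)"

section \<open>Matroids and connectivity\<close>

record 'e matroid =
  ground :: "'e set"
  indep :: "'e set \<Rightarrow> bool"

definition is_matroid :: "'e matroid \<Rightarrow> bool" where
  "is_matroid M \<longleftrightarrow>
     finite (ground M) \<and>
     (\<forall>X. indep M X \<longrightarrow> X \<subseteq> ground M) \<and>
     indep M {} \<and>
     (\<forall>X Y. indep M Y \<longrightarrow> X \<subseteq> Y \<longrightarrow> indep M X) \<and>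
     (\<forall>X Y. indep M X \<longrightarrow> indep M Y \<longrightarrow> card X < card Y \<longrightarrow>
        (\<exists>y\<in>Y - X. indep M (insert y X)))"

definition dependent_set :: "'e matroid \<Rightarrow> 'e set \<Rightarrow> bool" where
  "dependent_set M S \<longleftrightarrow> S \<subseteq> ground M \<and> \<not> indep M S"

definition rank_of :: "'e matroid \<Rightarrow> 'e set \<Rightarrow> nat" where
  "rank_of M S = Max {card X |X. X \<subseteq> S \<and> indep M X}"

definition matroid_rank :: "'e matroid \<Rightarrow> nat" where
  "matroid_rank M = rank_of M (ground M)"

definition connectivity :: "'e matroid \<Rightarrow> 'e set \<Rightarrow> int" where
  "connectivity M S =
     int (rank_of M S) + int (rank_of M (ground M - S)) - int (matroid_rank M)"

definition ordinary_separation :: "'e matroid \<Rightarrow> nat \<Rightarrow> 'e set \<Rightarrow> bool" where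
  "ordinary_separation M k S \<longleftrightarrow>
     S \<subseteq> ground M \<and> connectivity M S < int k \<and> k \<le> card S \<and> k \<le> card (ground M - S)"

definition cyclic_separation :: "'e matroid \<Rightarrow> nat \<Rightarrow> 'e set \<Rightarrow> bool" where
  "cyclic_separation M k S \<longleftrightarrow>
     S \<subseteq> ground M \<and> connectivity M S < int k \<and>
     dependent_set M S \<and> dependent_set M (ground M - S)"

text \<open>\<open>Inf {} = \<infinity>\<close> in \<open>enat\<close>.\<close>

definition tau :: "'e matroid \<Rightarrow> enat" where
  "tau M = Inf (enat ` {k. \<exists>S. ordinary_separation M k S})"

text \<open>On a nonempty set of natural numbers \<open>Inf\<close> is the minimum; \<open>Min\<close> would be
  unspecified here, as the set of all \<open>k\<close> admitting a cyclic separation may be infinite.\<close>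

definition kappa_star :: "'e matroid \<Rightarrow> nat" where
  "kappa_star M =
     Inf ({k. \<exists>S. cyclic_separation M k S} \<union> {card (ground M) - matroid_rank M})"

section \<open>The matroid represented by a matrix\<close>

text \<open>The matrix has rows indexed by \<open>R\<close> and columns indexed by \<open>C\<close>. A set of column
  indices is independent iff the corresponding family of columns is linearly independent;
  in particular, distinct indices with equal columns are dependent.\<close>

definition matrix_matroid :: "'r set \<Rightarrow> 'c set \<Rightarrow> ('r \<Rightarrow> 'c \<Rightarrow> 'f::field) \<Rightarrow> 'c matroid" where
  "matrix_matroid R C A = \<lparr>
     ground = C,
     indep = (\<lambda>X. X \<subseteq> C \<and>
       (\<forall>a. (\<forall>v\<in>R. (\<Sum>x\<in>X. a x * A v x) = 0) \<longrightarrow> (\<forall>x\<in>X. a x = 0))) \<rparr>"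

lemma matrix_matroid_augment:
  fixes A :: "'r \<Rightarrow> 'c \<Rightarrow> 'f::field"
  assumes C: "finite C"
    and X: "indep (matrix_matroid R C A) X" and Y: "indep (matrix_matroid R C A) Y"
    and less: "card X < card Y"
  shows "\<exists>y\<in>Y - X. indep (matrix_matroid R C A) (insert y X)"
proof (rule ccontr)
  assume neg: "\<not> ?thesis"
  interpret vs: vector_space "\<lambda>(c::'f) (f::'r \<Rightarrow> 'f) v. c * f v"
    by unfold_locales (auto simp: fun_eq_iff algebra_simps)
  define col where "col x = (\<lambda>v. if v \<in> R then A v x else 0)" for x
  have sum_app: "(\<Sum>x\<in>S. g x) v = (\<Sum>x\<in>S. g x v)"
    for S :: "'c set" and g :: "'c \<Rightarrow> 'r \<Rightarrow> 'f" and v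
    by (induction S rule: infinite_finite_induct) auto
  have XC: "X \<subseteq> C" and YC: "Y \<subseteq> C"
    and Xi: "\<And>a. \<forall>v\<in>R. (\<Sum>x\<in>X. a x * A v x) = 0 \<Longrightarrow> \<forall>x\<in>X. a x = 0"
    and Yi: "\<And>a. \<forall>v\<in>R. (\<Sum>x\<in>Y. a x * A v x) = 0 \<Longrightarrow> \<forall>x\<in>Y. a x = 0"
    using X Y by (auto simp: matrix_matroid_def)
  have fin: "finite X" "finite Y" using XC YC C by (auto intro: finite_subset)
  have span: "col y \<in> vs.span (col ` X)" if "y \<in> Y" for y
  proof (cases "y \<in> X")
    case False
    with neg that have "\<not> indep (matrix_matroid R C A) (insert y X)" by auto
    with XC YC that obtain a where a: "\<forall>v\<in>R. (\<Sum>x\<in>insert y X. a x * A v x) = 0"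
      and nz: "\<exists>x\<in>insert y X. a x \<noteq> 0" by (auto simp: matrix_matroid_def)
    have a': "a y * A v y = - (\<Sum>x\<in>X. a x * A v x)" if "v \<in> R" for v
      using a that False fin by (auto simp: eq_neg_iff_add_eq_0)
    have ay: "a y \<noteq> 0"
    proof
      assume "a y = 0"
      then have "\<forall>v\<in>R. (\<Sum>x\<in>X. a x * A v x) = 0" using a' by force
      from Xi[OF this] nz \<open>a y = 0\<close> show False by auto
    qed
    have "col y = (\<Sum>x\<in>X. (\<lambda>v. (- a x / a y) * col x v))"
    proof
      fix v
      have "(\<Sum>x\<in>X. (\<lambda>v. (- a x / a y) * col x v)) v = (\<Sum>x\<in>X. (- a x / a y) * col x v)"
        by (rule sum_app)
      also have "\<dots> = col y v"
      proof (cases "v \<in> R")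
        case True
        have "(\<Sum>x\<in>X. (- a x / a y) * col x v) = (- (\<Sum>x\<in>X. a x * A v x)) / a y"
          using True by (simp add: col_def sum_divide_distrib sum_negf)
        also have "\<dots> = col y v" using a'[OF True, symmetric] ay True by (simp add: col_def)
        finally show ?thesis .
      qed (simp add: col_def)
      finally show "col y v = (\<Sum>x\<in>X. (\<lambda>v. (- a x / a y) * col x v)) v" by simp
    qed
    also have "\<dots> \<in> vs.span (col ` X)"
      by (intro vs.span_sum vs.span_scale vs.span_base) auto
    finally show ?thesis .
  qed (auto intro: vs.span_base)
  have inj: "inj_on col Y"
  proof (rule inj_onI, rule ccontr)
    fix x y assume xy: "x \<in> Y" "y \<in> Y" "col x = col y" "x \<noteq> y"
    define a where "a = (\<lambda>z. if z = x then 1 else if z = y then - 1 else (0::'f))"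
    have "(\<Sum>z\<in>Y. a z * A v z) = 0" if "v \<in> R" for v
    proof -
      have "(\<Sum>z\<in>Y. a z * A v z) = (\<Sum>z\<in>{x, y}. a z * A v z)"
        using xy fin by (intro sum.mono_neutral_right) (auto simp: a_def)
      also have "\<dots> = A v x - A v y" using xy(4) by (simp add: a_def)
      also have "\<dots> = 0" using fun_cong[OF xy(3), of v] that by (simp add: col_def)
      finally show ?thesis .
    qed
    then have "a x = 0" using Yi[of a] xy(1) by blast
    then show False by (simp add: a_def)
  qed
  have ind: "\<not> vs.dependent (col ` Y)"
  proof
    assume "vs.dependent (col ` Y)"
    then obtain u w where w: "w \<in> col ` Y" "u w \<noteq> 0"
      and s: "(\<Sum>w\<in>col ` Y. (\<lambda>v. u w * w v)) = 0"
      using vs.dependent_finite[of "col ` Y"] fin by auto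
    have "(\<Sum>x\<in>Y. u (col x) * A v x) = 0" if "v \<in> R" for v
    proof -
      have "(\<Sum>x\<in>Y. u (col x) * A v x) = (\<Sum>x\<in>Y. (\<lambda>v. u (col x) * col x v)) v"
        unfolding sum_app using that by (simp add: col_def)
      also have "\<dots> = 0" using s by (simp add: sum.reindex[OF inj] o_def)
      finally show ?thesis .
    qed
    then show False using Yi[of "\<lambda>x. u (col x)"] w by auto
  qed
  have "card (col ` Y) \<le> card (col ` X)"
    using vs.independent_span_bound[of "col ` X" "col ` Y"] fin ind span by auto
  then show False
    using less card_image[OF inj] card_image_le[OF fin(1), of col] by linarith
qed

lemma is_matroid_matrix_matroid:
  fixes A :: "'r \<Rightarrow> 'c \<Rightarrow> 'f::field"
  assumes "finite C"
  shows "is_matroid (matrix_matroid R C A)"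
proof -
  have mono: "indep (matrix_matroid R C A) X"
    if Y: "indep (matrix_matroid R C A) Y" and sub: "X \<subseteq> Y" for X Y
  proof -
    have YC: "Y \<subseteq> C" using Y by (simp add: matrix_matroid_def)
    then have fin: "finite Y" using assms by (rule finite_subset)
    have "\<forall>x\<in>X. a x = 0" if a: "\<forall>v\<in>R. (\<Sum>x\<in>X. a x * A v x) = 0" for a
    proof -
      define b where "b x = (if x \<in> X then a x else 0)" for x
      have "(\<Sum>x\<in>Y. b x * A v x) = (\<Sum>x\<in>X. a x * A v x)" for v
        using sub fin by (intro sum.mono_neutral_cong_right) (auto simp: b_def)
      then have "\<forall>x\<in>Y. b x = 0" using a Y by (simp add: matrix_matroid_def)
      then show ?thesis using sub by (force simp: b_def)
    qed
    then show ?thesis using YC sub by (auto simp: matrix_matroid_def)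
  qed
  show ?thesis
    unfolding is_matroid_def
  proof (intro conjI allI impI)
    show "finite (ground (matrix_matroid R C A))" using assms by (simp add: matrix_matroid_def)
    show "indep (matrix_matroid R C A) {}" by (simp add: matrix_matroid_def)
    show "X \<subseteq> ground (matrix_matroid R C A)" if "indep (matrix_matroid R C A) X" for X
      using that by (simp add: matrix_matroid_def)
  qed (use mono matrix_matroid_augment[OF assms] in blast)+
qed

section \<open>The isotropic matroid of a graph\<close>

definition adjacency_matrix :: "'v graph \<Rightarrow> 'v \<Rightarrow> 'v \<Rightarrow> bit" where
  "adjacency_matrix G v w =
     (if v = w then of_bool (looped G v) else of_bool (w \<in> neighbors G v))"

datatype 'v isotropic_elt = Phi 'v | Chi 'v | Psi 'v

definition isotropic_ground :: "'v graph \<Rightarrow> 'v isotropic_elt set" where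
  "isotropic_ground G = Phi ` verts G \<union> Chi ` verts G \<union> Psi ` verts G"

fun IAS :: "'v graph \<Rightarrow> 'v \<Rightarrow> 'v isotropic_elt \<Rightarrow> bit" where
  "IAS G v (Phi w) = of_bool (v = w)"
| "IAS G v (Chi w) = adjacency_matrix G v w"
| "IAS G v (Psi w) = adjacency_matrix G v w + of_bool (v = w)"

definition isotropic_matroid :: "'v graph \<Rightarrow> 'v isotropic_elt matroid" where
  "isotropic_matroid G = matrix_matroid (verts G) (isotropic_ground G) (IAS G)"

lemma is_matroid_isotropic_matroid:
  "looped_simple_graph G \<Longrightarrow> is_matroid (isotropic_matroid G)"
  unfolding isotropic_matroid_def
  by (rule is_matroid_matrix_matroid) (simp add: isotropic_ground_def looped_simple_graph_def)

end

theory Submission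
  imports Defs
begin

text \<open>Given a bipartition \<open>(S, W - S)\<close> of the ground set, every vertex has at least two of its three
  elements on one of the sides, and these two span the third. Let \<open>X\<close> be the set of vertices with
  two elements in \<open>S\<close>. The unit vectors of \<open>X\<close> lie in the span of \<open>S\<close> and the other unit vectors in
  the span of \<open>W - S\<close>; an edge joining \<open>X\<close> to its complement adds one dimension on either side.
  Hence in a connected graph either \<open>\<lambda>(S) \<ge> 2\<close>, or one side spans everything and \<open>\<lambda>(S)\<close> is the rank
  of the other side. A set of rank less than two with at least two elements contains a zero column
  (an isolated vertex) or two equal columns, which mean a pendant vertex or a pair of twins.
  The upper bounds come from the elements over a component, a pair of equal columns, and
  the three elements over one vertex.\<close>

section \<open>Ranks in represented matroids\<close>

text \<open>Scaling is a constant of its own because the simplifier would rewrite the multiplication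
  of type \<^typ>\<open>bit\<close> inside the explicit function.\<close>

definition fun_scale :: "'f::field \<Rightarrow> ('r \<Rightarrow> 'f) \<Rightarrow> 'r \<Rightarrow> 'f" where
  "fun_scale c f = (\<lambda>v. c * f v)"

lemma fun_scale_apply [simp]: "fun_scale c f v = c * f v"
  by (simp add: fun_scale_def)

interpretation fun_space: vector_space "fun_scale :: 'f::field \<Rightarrow> ('r \<Rightarrow> 'f) \<Rightarrow> 'r \<Rightarrow> 'f"
  by unfold_locales (auto simp: fun_eq_iff algebra_simps)

lemma sum_fun_apply: "(\<Sum>x\<in>S. g x) v = (\<Sum>x\<in>S. g x v)"
  for g :: "'c \<Rightarrow> 'r \<Rightarrow> 'f::comm_monoid_add"
  by (induction S rule: infinite_finite_induct) auto

text \<open>Padding with zeros outside \<open>R\<close> turns a relation required only on the rows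
  of \<open>R\<close> into an equation between functions, so that the vector space theory of
  functions applies.\<close>

definition matrix_column :: "'r set \<Rightarrow> ('r \<Rightarrow> 'c \<Rightarrow> 'f::field) \<Rightarrow> 'c \<Rightarrow> 'r \<Rightarrow> 'f" where
  "matrix_column R A x = (\<lambda>v. if v \<in> R then A v x else 0)"

lemma ground_matrix_matroid [simp]: "ground (matrix_matroid R C A) = C"
  by (simp add: matrix_matroid_def)

lemma columns_relation_iff:
  "(\<forall>v\<in>R. (\<Sum>x\<in>X. a x * A v x) = 0) \<longleftrightarrow> (\<Sum>x\<in>X. fun_scale (a x) (matrix_column R A x)) = 0"
proof -
  have "(\<Sum>x\<in>X. fun_scale (a x) (matrix_column R A x)) v =
      (if v \<in> R then \<Sum>x\<in>X. a x * A v x else 0)" for v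
    by (simp add: sum_fun_apply matrix_column_def)
  then show ?thesis by (auto simp: fun_eq_iff)
qed

text \<open>Matroid independence concerns an indexed family, \<open>dependent\<close> a set of
  vectors. The image forgets repeated columns, so injectivity has to be demanded separately.\<close>

lemma indep_matrix_matroid_iff:
  fixes A :: "'r \<Rightarrow> 'c \<Rightarrow> 'f::field"
  assumes "finite C"
  shows "indep (matrix_matroid R C A) X \<longleftrightarrow>
    X \<subseteq> C \<and> inj_on (matrix_column R A) X \<and>
    \<not> fun_space.dependent (matrix_column R A ` X)"
proof (cases "X \<subseteq> C")
  case True
  let ?col = "matrix_column R A"
  have fin: "finite X" using True assms finite_subset by blast
  have ind: "indep (matrix_matroid R C A) X \<longleftrightarrow>
      (\<forall>a. (\<Sum>x\<in>X. fun_scale (a x) (?col x)) = 0 \<longrightarrow> (\<forall>x\<in>X. a x = 0))"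
    using True by (simp add: matrix_matroid_def columns_relation_iff)
  have inj: "inj_on ?col X" if i: "indep (matrix_matroid R C A) X"
  proof (rule inj_onI, rule ccontr)
    fix x y assume xy: "x \<in> X" "y \<in> X" "?col x = ?col y" "x \<noteq> y"
    \<comment> \<open>Two equal columns cancel with coefficients 1 and -1.\<close>
    define a where "a = (\<lambda>z. if z = x then 1 else if z = y then - 1 else (0::'f))"
    have "(\<Sum>z\<in>X. fun_scale (a z) (?col z)) = (\<Sum>z\<in>{x, y}. fun_scale (a z) (?col z))"
      using xy fin by (intro sum.mono_neutral_right) (auto simp: a_def fun_eq_iff)
    also have "\<dots> = 0" using xy(3,4) by (auto simp: a_def fun_eq_iff)
    finally have "a x = 0" using i xy(1) ind by blast
    then show False by (simp add: a_def)
  qed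
  have "indep (matrix_matroid R C A) X \<longleftrightarrow> \<not> fun_space.dependent (?col ` X)"
    if inj: "inj_on ?col X"
  proof -
    have dep: "fun_space.dependent (?col ` X) \<longleftrightarrow>
        (\<exists>u. (\<exists>x\<in>X. u (?col x) \<noteq> 0) \<and> (\<Sum>x\<in>X. fun_scale (u (?col x)) (?col x)) = 0)"
      using fun_space.dependent_finite[of "?col ` X"] fin by (simp add: sum.reindex[OF inj] o_def)
    \<comment> \<open>Injectivity carries coefficients on indices over to coefficients on vectors,
      so the two kinds of linear relation correspond.\<close>
    have ex: "\<exists>u. \<forall>x\<in>X. u (?col x) = a x" for a :: "'c \<Rightarrow> 'f"
      using inj by (intro exI[of _ "\<lambda>w. a (the_inv_into X ?col w)"]) (simp add: the_inv_into_f_f)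
    have "(\<exists>u. (\<exists>x\<in>X. u (?col x) \<noteq> 0) \<and> (\<Sum>x\<in>X. fun_scale (u (?col x)) (?col x)) = 0)
      \<longleftrightarrow> (\<exists>a. (\<exists>x\<in>X. a x \<noteq> 0) \<and> (\<Sum>x\<in>X. fun_scale (a x) (?col x)) = 0)"
    proof
      assume "\<exists>a. (\<exists>x\<in>X. a x \<noteq> 0) \<and> (\<Sum>x\<in>X. fun_scale (a x) (?col x)) = 0"
      then obtain a where a: "\<exists>x\<in>X. a x \<noteq> 0" "(\<Sum>x\<in>X. fun_scale (a x) (?col x)) = 0" by blast
      obtain u where u: "\<forall>x\<in>X. u (?col x) = a x" using ex by blast
      then have "(\<Sum>x\<in>X. fun_scale (u (?col x)) (?col x)) = (\<Sum>x\<in>X. fun_scale (a x) (?col x))"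
        by (intro sum.cong) auto
      with a u show "\<exists>u. (\<exists>x\<in>X. u (?col x) \<noteq> 0) \<and>
          (\<Sum>x\<in>X. fun_scale (u (?col x)) (?col x)) = 0" by metis
    qed (elim exE, rule exI)
    then show ?thesis unfolding dep ind by blast
  qed
  with inj True show ?thesis by blast
qed (simp add: matrix_matroid_def)

text \<open>A basis of the span chosen among the columns lifts to an independent index set with one
  index per vector. No independent subset of \<open>S\<close> is larger, because its columns are
  independent vectors in the same span.\<close>

lemma rank_of_matrix_matroid:
  fixes A :: "'r \<Rightarrow> 'c \<Rightarrow> 'f::field"
  assumes C: "finite C" and S: "S \<subseteq> C"
  shows "rank_of (matrix_matroid R C A) S = fun_space.dim (matrix_column R A ` S)"
proof -
  let ?col = "matrix_column R A"
  have fin: "finite S" using S C finite_subset by blast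
  obtain B where B: "B \<subseteq> ?col ` S" "\<not> fun_space.dependent B" "?col ` S \<subseteq> fun_space.span B"
    using fun_space.maximal_independent_subset[of "?col ` S"] by blast
  obtain X where X: "X \<subseteq> S" "inj_on ?col X" "B = ?col ` X"
    using B(1) subset_image_inj by metis
  have finB: "finite B" using B(1) fin finite_surj by blast
  have XI: "indep (matrix_matroid R C A) X"
    using X B S C by (auto simp: indep_matrix_matroid_iff)
  have "card Y \<le> card B" if "Y \<subseteq> S" "indep (matrix_matroid R C A) Y" for Y
  proof -
    have Y: "inj_on ?col Y" "\<not> fun_space.dependent (?col ` Y)"
      using that C by (auto simp: indep_matrix_matroid_iff)
    then have "card (?col ` Y) \<le> card B"
      using fun_space.independent_span_bound[OF finB Y(2)] B(3) that(1) by blast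
    with Y(1) show ?thesis by (simp add: card_image)
  qed
  moreover have "card X = card B" using X by (simp add: card_image)
  moreover have "finite {card X |X. X \<subseteq> S \<and> indep (matrix_matroid R C A) X}"
    using fin by (auto intro: finite_subset[of _ "card ` Pow S"])
  ultimately have "rank_of (matrix_matroid R C A) S = card B"
    unfolding rank_of_def using X(1) XI by (intro Max_eqI) (auto intro: exI[of _ X])
  with B fun_space.dim_unique show ?thesis by metis
qed

lemma rank_of_matrix_matroid_le:
  assumes "finite C" "S \<subseteq> C" "finite B" "matrix_column R A ` S \<subseteq> fun_space.span B"
  shows "rank_of (matrix_matroid R C A) S \<le> card B"
  using assms fun_space.dim_le_card by (simp add: rank_of_matrix_matroid)

text \<open>The vectors in \<open>B\<close> need not be columns of \<open>S\<close>. This permits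
  counting unit vectors that \<open>S\<close> merely spans.\<close>

lemma rank_of_matrix_matroid_ge:
  assumes C: "finite C" and S: "S \<subseteq> C"
    and B: "\<not> fun_space.dependent B" "B \<subseteq> fun_space.span (matrix_column R A ` S)"
  shows "card B \<le> rank_of (matrix_matroid R C A) S"
proof -
  obtain D where D: "D \<subseteq> matrix_column R A ` S" "\<not> fun_space.dependent D"
    "matrix_column R A ` S \<subseteq> fun_space.span D" "card D = fun_space.dim (matrix_column R A ` S)"
    using fun_space.basis_exists by blast
  have "finite D" using D(1) S C finite_subset finite_imageI by metis
  moreover have "B \<subseteq> fun_space.span D"
    using B(2) D(3) fun_space.span_minimal[OF _ fun_space.subspace_span] by blast
  ultimately show ?thesis
    using fun_space.independent_span_bound[OF _ B(1)] D(4) C S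
    by (metis rank_of_matrix_matroid)
qed

section \<open>Separations and connectivity parameters\<close>

lemma tau_eqI:
  assumes "ordinary_separation M k S" "\<And>j T. ordinary_separation M j T \<Longrightarrow> k \<le> j"
  shows "tau M = enat k"
  unfolding tau_def
proof (rule antisym)
  show "Inf (enat ` {k. \<exists>S. ordinary_separation M k S}) \<le> enat k"
    using assms(1) by (intro Inf_lower) auto
  show "enat k \<le> Inf (enat ` {k. \<exists>S. ordinary_separation M k S})"
    using assms(2) by (intro Inf_greatest) auto
qed

lemma kappa_star_eqI:
  assumes "cyclic_separation M k S" "\<And>j T. cyclic_separation M j T \<Longrightarrow> k \<le> j"
    and "k \<le> card (ground M) - matroid_rank M"
  shows "kappa_star M = k"
  unfolding kappa_star_def
proof (rule cInf_eq_minimum)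
  show "k \<in> {k. \<exists>S. cyclic_separation M k S} \<union> {card (ground M) - matroid_rank M}"
    using assms(1) by blast
qed (use assms in auto)

section \<open>Columns of the isotropic matroid\<close>

lemma bit_add_eq_0: "a + b = 0 \<longleftrightarrow> a = b" for a b :: bit
  by (cases a; cases b) auto

locale isotropic =
  fixes G :: "'v graph"
  assumes graph: "looped_simple_graph G"
begin

abbreviation "V \<equiv> verts G"
abbreviation "W \<equiv> isotropic_ground G"
abbreviation "M \<equiv> isotropic_matroid G"
abbreviation "N \<equiv> neighbors G"
abbreviation "col \<equiv> matrix_column V (IAS G)"

lemma finite_V [simp]: "finite V"
  using graph by (simp add: looped_simple_graph_def)

lemma finite_W [simp]: "finite W"
  by (simp add: isotropic_ground_def)

lemma ground_M [simp]: "ground M = W"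
  by (simp add: isotropic_matroid_def)

lemma card_W: "card W = 3 * card V"
proof -
  have "card (Phi ` V) = card V" "card (Chi ` V) = card V" "card (Psi ` V) = card V"
    by (auto intro!: card_image inj_onI)
  moreover have "card W = card (Phi ` V) + card (Chi ` V) + card (Psi ` V)"
    unfolding isotropic_ground_def by (subst card_Un_disjoint, auto)+
  ultimately show ?thesis by simp
qed

lemma in_W [simp]: "Phi v \<in> W \<longleftrightarrow> v \<in> V" "Chi v \<in> W \<longleftrightarrow> v \<in> V" "Psi v \<in> W \<longleftrightarrow> v \<in> V"
  by (auto simp: isotropic_ground_def)

lemma neighbor_in_V: "w \<in> N v \<Longrightarrow> w \<in> V \<and> v \<in> V"
  using graph by (auto simp: looped_simple_graph_def neighbors_def)

lemma neighbor_sym: "w \<in> N v \<longleftrightarrow> v \<in> N w"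
  by (auto simp: neighbors_def insert_commute)

lemma not_self_neighbor [simp]: "v \<notin> N v"
  by (simp add: neighbors_def)

lemma col_Phi: "v \<in> V \<Longrightarrow> col (Phi v) u = of_bool (u = v)"
  by (auto simp: matrix_column_def)

text \<open>Loops and the choice between \<open>Chi\<close> and \<open>Psi\<close> affect the
  diagonal entry only; elsewhere both columns are the indicator function of the
  neighborhood.\<close>

lemma col_off_diagonal:
  assumes "x = Chi v \<or> x = Psi v" "u \<noteq> v"
  shows "col x u = of_bool (u \<in> N v)"
  using assms neighbor_in_V[of u v] neighbor_sym[of u v]
  by (auto simp: matrix_column_def adjacency_matrix_def)

lemma col_outside: "u \<notin> V \<Longrightarrow> col x u = 0"
  by (simp add: matrix_column_def)

lemma col_Psi: "col (Psi v) = col (Phi v) + col (Chi v)"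
  by (auto simp: matrix_column_def fun_eq_iff)

lemma col_Psi_neq_Chi: "v \<in> V \<Longrightarrow> col (Psi v) \<noteq> col (Chi v)"
  by (auto simp: col_Psi fun_eq_iff col_Phi intro!: exI[of _ v])

text \<open>The columns of \<open>Chi v\<close> and \<open>Psi v\<close> differ exactly at
  \<open>v\<close>, so one of them has the prescribed diagonal entry, whether or not
  \<open>v\<close> is looped.\<close>

lemma obtain_column:
  assumes "v \<in> V"
  obtains x where "x = Chi v \<or> x = Psi v" "col x = (\<lambda>u. if u = v then b else of_bool (u \<in> N v))"
proof -
  have "col (Chi v) v = b \<or> col (Psi v) v = b"
    using assms by (cases b; cases "col (Chi v) v") (auto simp: col_Psi col_Phi)
  then obtain x where x: "x = Chi v \<or> x = Psi v" "col x v = b" by blast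
  then have "col x = (\<lambda>u. if u = v then b else of_bool (u \<in> N v))"
    using col_off_diagonal by (auto simp: fun_eq_iff)
  with x that show thesis by blast
qed

section \<open>Rank bounds from supports and from vertices met twice\<close>

lemma rank_le:
  assumes "S \<subseteq> W" "finite B" "col ` S \<subseteq> fun_space.span B"
  shows "rank_of M S \<le> card B"
  using rank_of_matrix_matroid_le[OF finite_W assms] by (simp add: isotropic_matroid_def)

lemma rank_ge:
  assumes "S \<subseteq> W" "\<not> fun_space.dependent B" "B \<subseteq> fun_space.span (col ` S)"
  shows "card B \<le> rank_of M S"
  using rank_of_matrix_matroid_ge[OF finite_W assms] by (simp add: isotropic_matroid_def)

lemma indep_iff: "indep M X \<longleftrightarrow> X \<subseteq> W \<and> inj_on col X \<and> \<not> fun_space.dependent (col ` X)"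
  unfolding isotropic_matroid_def by (rule indep_matrix_matroid_iff) simp

lemma inj_col_Phi: "X \<subseteq> V \<Longrightarrow> inj_on (\<lambda>v. col (Phi v)) X"
proof (rule inj_onI)
  fix v w assume "X \<subseteq> V" "v \<in> X" "w \<in> X" and eq: "col (Phi v) = col (Phi w)"
  then have "v \<in> V" "w \<in> V" by auto
  with fun_cong[OF eq, of v] show "v = w" by (simp add: col_Phi)
qed

lemma card_col_Phi: "X \<subseteq> V \<Longrightarrow> card ((\<lambda>v. col (Phi v)) ` X) = card X"
  by (rule card_image) (rule inj_col_Phi)

lemma span_col_Phi:
  assumes "X \<subseteq> V"
  shows "fun_space.span ((\<lambda>v. col (Phi v)) ` X) = {f. \<forall>u. u \<notin> X \<longrightarrow> f u = 0}"
proof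
  have "fun_space.subspace {f :: 'v \<Rightarrow> bit. \<forall>u. u \<notin> X \<longrightarrow> f u = 0}"
    by (auto simp: fun_space.subspace_def)
  then show "fun_space.span ((\<lambda>v. col (Phi v)) ` X) \<subseteq> {f. \<forall>u. u \<notin> X \<longrightarrow> f u = 0}"
    using assms by (intro fun_space.span_minimal) (auto simp: col_Phi subset_iff)
  show "{f. \<forall>u. u \<notin> X \<longrightarrow> f u = 0} \<subseteq> fun_space.span ((\<lambda>v. col (Phi v)) ` X)"
  proof safe
    fix f :: "'v \<Rightarrow> bit" assume f: "\<forall>u. u \<notin> X \<longrightarrow> f u = 0"
    have fin: "finite X" using assms finite_subset finite_V by blast
    have "f = (\<Sum>v\<in>X. fun_scale (f v) (col (Phi v)))"
    proof
      fix u
      have "(\<Sum>v\<in>X. f v * col (Phi v) u) = (\<Sum>v\<in>X. if u = v then f v else 0)"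
        using assms by (intro sum.cong) (auto simp: col_Phi)
      also have "\<dots> = f u" using f fin by simp
      finally show "f u = (\<Sum>v\<in>X. fun_scale (f v) (col (Phi v))) u" by (simp add: sum_fun_apply)
    qed
    also have "\<dots> \<in> fun_space.span ((\<lambda>v. col (Phi v)) ` X)"
      by (intro fun_space.span_sum fun_space.span_scale fun_space.span_base imageI)
    finally show "f \<in> fun_space.span ((\<lambda>v. col (Phi v)) ` X)" .
  qed
qed

text \<open>Combinations of the other unit vectors vanish at \<open>v\<close>, where the unit vector
  of \<open>v\<close> is 1.\<close>

lemma independent_col_Phi:
  assumes "X \<subseteq> V"
  shows "\<not> fun_space.dependent ((\<lambda>v. col (Phi v)) ` X)"
proof
  assume "fun_space.dependent ((\<lambda>v. col (Phi v)) ` X)"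
  then obtain v where v: "v \<in> X"
    "col (Phi v) \<in> fun_space.span ((\<lambda>v. col (Phi v)) ` X - {col (Phi v)})"
    unfolding fun_space.dependent_def by blast
  have "(\<lambda>v. col (Phi v)) ` X - {col (Phi v)} = (\<lambda>v. col (Phi v)) ` (X - {v})"
    using inj_col_Phi[OF assms] v(1) by (auto dest: inj_onD)
  with v span_col_Phi[of "X - {v}"] assms have "col (Phi v) v = 0" by auto
  with v(1) assms show False by (auto simp: col_Phi)
qed

lemma rank_le_support:
  assumes "S \<subseteq> W" "X \<subseteq> V" "\<And>x u. x \<in> S \<Longrightarrow> u \<in> V - X \<Longrightarrow> col x u = 0"
  shows "rank_of M S \<le> card X"
proof -
  have "col ` S \<subseteq> fun_space.span ((\<lambda>v. col (Phi v)) ` X)"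
    unfolding span_col_Phi[OF assms(2)] using assms(3) col_outside by blast
  from rank_le[OF assms(1) _ this] assms(2) finite_subset[OF assms(2)] show ?thesis
    by (simp add: card_col_Phi)
qed

definition met_twice :: "'v isotropic_elt set \<Rightarrow> 'v \<Rightarrow> bool" where
  "met_twice S v \<longleftrightarrow> (Phi v \<in> S \<and> Chi v \<in> S) \<or> (Phi v \<in> S \<and> Psi v \<in> S) \<or> (Chi v \<in> S \<and> Psi v \<in> S)"

lemma met_twice_compl: "v \<in> V \<Longrightarrow> \<not> met_twice S v \<Longrightarrow> met_twice (W - S) v"
  by (auto simp: met_twice_def)

text \<open>The three columns over a vertex sum to zero over GF(2), so any two of them span the
  third.\<close>

lemma met_twice_span:
  assumes "met_twice S v"
  shows "col (Phi v) \<in> fun_space.span (col ` S)" "col (Chi v) \<in> fun_space.span (col ` S)"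
proof -
  have *: "col (Phi v) = col (Chi v) + col (Psi v)" "col (Chi v) = col (Phi v) + col (Psi v)"
    by (auto simp: fun_eq_iff matrix_column_def algebra_simps bit_add_eq_0)
  have base: "col x \<in> fun_space.span (col ` S)" if "x \<in> S" for x
    using that by (simp add: fun_space.span_base)
  have "col (Phi v) \<in> fun_space.span (col ` S)" if "Chi v \<in> S" "Psi v \<in> S"
    by (subst *(1)) (intro fun_space.span_add base that)
  then show "col (Phi v) \<in> fun_space.span (col ` S)"
    using assms base unfolding met_twice_def by blast
  have "col (Chi v) \<in> fun_space.span (col ` S)" if "Phi v \<in> S" "Psi v \<in> S"
    by (subst *(2)) (intro fun_space.span_add base that)
  then show "col (Chi v) \<in> fun_space.span (col ` S)"
    using assms base unfolding met_twice_def by blast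
qed

lemma rank_ge_met_twice:
  assumes "S \<subseteq> W" "X \<subseteq> V" "\<And>v. v \<in> X \<Longrightarrow> met_twice S v"
  shows "card X \<le> rank_of M S"
proof -
  have "(\<lambda>v. col (Phi v)) ` X \<subseteq> fun_space.span (col ` S)"
    using assms(3) met_twice_span(1) by blast
  from rank_ge[OF assms(1) independent_col_Phi[OF assms(2)] this] show ?thesis
    by (simp only: card_col_Phi[OF assms(2)])
qed

text \<open>The column of \<open>Chi x\<close> has entry 1 at \<open>y\<close> and so lies outside
  the span of the unit vectors of \<open>X\<close>, yet inside the span of \<open>S\<close>. It adds
  one dimension to those unit vectors.\<close>

lemma rank_gt_met_twice:
  assumes "S \<subseteq> W" "X \<subseteq> V" "\<And>v. v \<in> X \<Longrightarrow> met_twice S v"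
    and xy: "x \<in> X" "y \<in> N x" "y \<notin> X"
  shows "card X < rank_of M S"
proof -
  let ?B = "(\<lambda>v. col (Phi v)) ` X"
  have "col (Chi x) y = 1"
    using xy by (subst col_off_diagonal[of _ x]) auto
  then have nin: "col (Chi x) \<notin> fun_space.span ?B"
    unfolding span_col_Phi[OF assms(2)] using xy(3) by auto
  then have "\<not> fun_space.dependent (insert (col (Chi x)) ?B)"
    using independent_col_Phi[OF assms(2)] by (rule fun_space.independent_insertI)
  moreover have "insert (col (Chi x)) ?B \<subseteq> fun_space.span (col ` S)"
    using assms(3) xy(1) met_twice_span by auto
  ultimately have "card (insert (col (Chi x)) ?B) \<le> rank_of M S"
    by (rule rank_ge[OF assms(1)])
  moreover have "col (Chi x) \<notin> ?B" using nin fun_space.span_superset[of ?B] by (rule contra_subsetD[rotated])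
  moreover have "finite X" using assms(2) finite_subset finite_V by blast
  ultimately show ?thesis by (simp add: card_col_Phi[OF assms(2)])
qed

lemma rank_le_card_V: "S \<subseteq> W \<Longrightarrow> rank_of M S \<le> card V"
  by (rule rank_le_support) simp_all

lemma rank_eq_card_V:
  assumes "S \<subseteq> W" "\<And>v. v \<in> V \<Longrightarrow> met_twice S v"
  shows "rank_of M S = card V"
  using assms by (intro antisym rank_le_card_V rank_ge_met_twice) auto

lemma matroid_rank_M: "matroid_rank M = card V"
  unfolding matroid_rank_def ground_M by (rule rank_eq_card_V) (auto simp: met_twice_def)

lemma dependent_of_card:
  assumes "S \<subseteq> W" "card V < card S"
  shows "dependent_set M S"
proof -
  have "\<not> indep M S"
  proof
    assume "indep M S"
    then have "card (col ` S) = card S" "\<not> fun_space.dependent (col ` S)"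
      by (auto simp: indep_iff card_image)
    then show False
      using rank_ge[OF assms(1) _ fun_space.span_superset] rank_le_card_V[OF assms(1)] assms(2)
      by simp
  qed
  with assms show ?thesis by (simp add: dependent_set_def)
qed

lemma dependent_of_triple:
  assumes "S \<subseteq> W" "v \<in> V" "Phi v \<in> S" "Chi v \<in> S" "Psi v \<in> S"
  shows "dependent_set M S"
proof -
  have "\<not> indep M S"
  proof
    assume "indep M S"
    then have inj: "inj_on col S" and ind: "\<not> fun_space.dependent (col ` S)"
      by (auto simp: indep_iff)
    \<comment> \<open>By injectivity both columns differ from that of \<open>Psi v\<close> and
      survive its removal.\<close>
    have "col (Phi v) \<in> col ` S - {col (Psi v)}" "col (Chi v) \<in> col ` S - {col (Psi v)}"
      using assms(3-5) inj by (auto dest: inj_onD)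
    then have "col (Psi v) \<in> fun_space.span (col ` S - {col (Psi v)})"
      unfolding col_Psi[of v] by (intro fun_space.span_add fun_space.span_base)
    with assms(5) ind show False unfolding fun_space.dependent_def by blast
  qed
  with assms show ?thesis by (simp add: dependent_set_def)
qed

section \<open>Lower bounds for the connectivity function\<close>

lemma connectivity_nonneg:
  assumes "S \<subseteq> W"
  shows "0 \<le> connectivity M S"
proof -
  let ?X = "{v \<in> V. met_twice S v}"
  \<comment> \<open>The lower bounds for the two sides add up to the number of vertices, which is
    the rank of \<open>M\<close>.\<close>
  have "card ?X \<le> rank_of M S" by (rule rank_ge_met_twice) (use assms in auto)
  moreover have "card (V - ?X) \<le> rank_of M (W - S)"
    by (rule rank_ge_met_twice) (auto intro: met_twice_compl)
  moreover have "card ?X + card (V - ?X) = card V"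
    using card_mono[of V ?X] by (simp add: card_Diff_subset)
  ultimately show ?thesis by (simp add: connectivity_def matroid_rank_M)
qed

text \<open>If no edge left \<open>X\<close>, a walk from \<open>u\<close> to \<open>w\<close> would
  stay in \<open>X\<close>, by induction along the walk.\<close>

lemma edge_across:
  assumes "connected_graph G" "u \<in> X" "X \<subseteq> V" "w \<in> V - X"
  shows "\<exists>x\<in>X. \<exists>y\<in>N x. y \<notin> X"
proof (rule ccontr)
  assume neg: "\<not> ?thesis"
  have "(\<lambda>x y. y \<in> N x)\<^sup>*\<^sup>* u w" using assms by (auto simp: connected_graph_def)
  then have "w \<in> X" by induction (use neg assms(2) in auto)
  with assms(4) show False by simp
qed

text \<open>A side meeting every vertex twice has full rank, which cancels against the rank of
  \<open>M\<close> and leaves the rank of the other side. If neither side does so, an edge across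
  the vertex partition raises both rank bounds by one.\<close>

lemma connectivity_cases:
  assumes "connected_graph G" "S \<subseteq> W"
  shows "2 \<le> connectivity M S \<or>
    connectivity M S = int (rank_of M S) \<or> connectivity M S = int (rank_of M (W - S))"
proof -
  let ?X = "{v \<in> V. met_twice S v}"
  consider "?X = {}" | "?X = V" | u w where "u \<in> ?X" "w \<in> V - ?X" by blast
  then show ?thesis
  proof cases
    case 1
    then have "rank_of M (W - S) = card V"
      using met_twice_compl by (intro rank_eq_card_V) auto
    then show ?thesis by (simp add: connectivity_def matroid_rank_M)
  next
    case 2
    then have "rank_of M S = card V"
      using assms by (intro rank_eq_card_V) auto
    then show ?thesis by (simp add: connectivity_def matroid_rank_M)
  next
    case 3
    then obtain x y where xy: "x \<in> ?X" "y \<in> N x" "y \<notin> ?X"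
      using edge_across[OF assms(1) 3(1) _ 3(2)] by blast
    have "card ?X < rank_of M S" by (rule rank_gt_met_twice[OF _ _ _ xy]) (use assms in auto)
    moreover have "card (V - ?X) < rank_of M (W - S)"
    \<comment> \<open>The same edge serves the other side when read from \<open>y\<close> to
      \<open>x\<close>.\<close>
    proof (rule rank_gt_met_twice[of _ _ y x])
      show "y \<in> V - ?X" using xy neighbor_in_V by blast
    qed (use xy neighbor_sym met_twice_compl in auto)
    moreover have "card ?X + card (V - ?X) = card V"
      using card_mono[of V ?X] by (simp add: card_Diff_subset)
    ultimately show ?thesis by (simp add: connectivity_def matroid_rank_M)
  qed
qed

section \<open>Zero columns and equal columns\<close>

lemma neighbors_nonempty:
  assumes "connected_graph G" "card V > 1" "v \<in> V"
  shows "N v \<noteq> {}"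
proof -
  have "V \<noteq> {v}" using assms(2) by auto
  then obtain w where "w \<in> V - {v}" using assms(3) by blast
  then show ?thesis using edge_across[OF assms(1), of v "{v}" w] assms(3) by auto
qed

lemma W_cases:
  assumes "x \<in> W"
  obtains v where "v \<in> V" "x = Phi v" | v where "v \<in> V" "x = Chi v \<or> x = Psi v"
  using assms by (auto simp: isotropic_ground_def)

text \<open>A \<open>Phi\<close> column is a unit vector, and a \<open>Chi\<close> or
  \<open>Psi\<close> column has entry 1 at any neighbor, which exists by connectedness.\<close>

lemma col_nonzero:
  assumes "connected_graph G" "card V > 1" "x \<in> W"
  shows "col x \<noteq> 0"
  using assms(3)
proof (cases rule: W_cases)
  case (1 v)
  then have "col x v = 1" by (simp add: col_Phi)
  then show ?thesis by force
next
  case (2 v)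
  obtain u where "u \<in> N v" using neighbors_nonempty assms(1,2) 2(1) by blast
  moreover from this have "u \<noteq> v" by auto
  ultimately have "col x u = 1" using col_off_diagonal[OF 2(2)] by simp
  then show ?thesis by force
qed

lemma equal_columns_pendant_or_twins:
  assumes G: "connected_graph G" "card V > 1"
    and xy: "x \<in> W" "y \<in> W" "x \<noteq> y" "col x = col y"
  shows "(\<exists>v w. pendant_on G v w) \<or> (\<exists>v w. twins G v w)"
proof -
  \<comment> \<open>The mixed case, stated once because it occurs with \<open>x\<close> and
    \<open>y\<close> in either order. The column of \<open>z\<close> then has no off-diagonal 1
    except possibly at \<open>v\<close>.\<close>
  have pend: "pendant_on G w v" if "v \<in> V" "w \<in> V" "z = Chi w \<or> z = Psi w" "col z = col (Phi v)"
    for v w z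
  proof -
    have eq: "u \<in> N w \<longleftrightarrow> u = v" if "u \<noteq> w" for u
      using col_off_diagonal[OF \<open>z = Chi w \<or> z = Psi w\<close> that] \<open>col z = col (Phi v)\<close>
      by (auto simp: col_Phi[OF \<open>v \<in> V\<close>] of_bool_eq_iff)
    have "N w \<subseteq> {v}" using eq by (metis not_self_neighbor singletonI subsetI)
    then have "N w = {v}" using neighbors_nonempty[OF G that(2)] by blast
    with that show ?thesis by (simp add: pendant_on_def)
  qed
  from xy(1) show ?thesis
  proof (cases rule: W_cases)
    case x: (1 v)
    from xy(2) show ?thesis
    proof (cases rule: W_cases)
      case (1 w)
      with x xy(3,4) inj_col_Phi[of V] show ?thesis by (auto dest: inj_onD)
    next
      case (2 w)
      with x xy(4) pend[of v w y] show ?thesis by auto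
    qed
  next
    case x: (2 v)
    from xy(2) show ?thesis
    proof (cases rule: W_cases)
      case (1 w)
      with x xy(4) pend[of w v x] show ?thesis by auto
    next
      case (2 w)
      \<comment> \<open>Over a single vertex, \<open>x\<close> and \<open>y\<close> would be its
        \<open>Chi\<close> and \<open>Psi\<close> elements, whose columns differ on the
        diagonal.\<close>
      have "v \<noteq> w"
        using x 2 xy(3,4) col_Psi_neq_Chi by metis
      moreover have "u \<in> N v \<longleftrightarrow> u \<in> N w" if "u \<noteq> v" "u \<noteq> w" for u
        using col_off_diagonal[OF x(2) that(1)] col_off_diagonal[OF 2(2) that(2)] xy(4)
        by (simp add: of_bool_eq_iff)
      then have "N v - {w} = N w - {v}"
        by (intro set_eqI) (metis Diff_iff not_self_neighbor singletonD singletonI)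
      ultimately have "twins G v w" using x(1) 2(1) by (simp add: twins_def)
      then show ?thesis by blast
    qed
  qed
qed

lemma obtain_equal_columns:
  assumes "(\<exists>v w. pendant_on G v w) \<or> (\<exists>v w. twins G v w)"
  obtains x y where "x \<in> W" "y \<in> W" "x \<noteq> y" "col x = col y"
  using assms
proof (elim disjE exE)
  fix v w assume "pendant_on G v w"
  then have p: "v \<in> V" "w \<in> V" "N v = {w}" by (auto simp: pendant_on_def)
  then have "v \<noteq> w" using not_self_neighbor by blast
  \<comment> \<open>The diagonal entry is taken to be 0 because the unit vector of \<open>w\<close>
    vanishes at \<open>v\<close>.\<close>
  obtain x where x: "x = Chi v \<or> x = Psi v" "col x = (\<lambda>u. if u = v then 0 else of_bool (u \<in> N v))"
    using obtain_column[OF p(1)] by blast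
  have "col x = col (Phi w)"
    using x(2) p \<open>v \<noteq> w\<close> by (auto simp: fun_eq_iff col_Phi)
  with x(1) p that[of x "Phi w"] show thesis by auto
next
  fix v w assume "twins G v w"
  then have t: "v \<in> V" "w \<in> V" "v \<noteq> w" "N v - {w} = N w - {v}" by (auto simp: twins_def)
  \<comment> \<open>Each diagonal entry records whether \<open>v\<close> and \<open>w\<close> are
    adjacent, since this is the entry of the other column at that vertex.\<close>
  obtain x where x: "x = Chi v \<or> x = Psi v"
    "col x = (\<lambda>u. if u = v then of_bool (v \<in> N w) else of_bool (u \<in> N v))"
    using obtain_column[OF t(1)] by blast
  obtain y where y: "y = Chi w \<or> y = Psi w"
    "col y = (\<lambda>u. if u = w then of_bool (w \<in> N v) else of_bool (u \<in> N w))"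
    using obtain_column[OF t(2)] by blast
  have "u \<in> N v \<longleftrightarrow> u \<in> N w" if "u \<noteq> v" "u \<noteq> w" for u using t(4) that by blast
  then have "col x = col y" using x(2) y(2) t(3) by (auto simp: fun_eq_iff)
  moreover have "x \<in> W" "y \<in> W" "x \<noteq> y" using x(1) y(1) t(1-3) by auto
  ultimately show thesis by (intro that)
qed

section \<open>Lower bounds for the order of a separation\<close>

lemma rank_pos:
  assumes "connected_graph G" "card V > 1" "S \<subseteq> W" "S \<noteq> {}"
  shows "1 \<le> rank_of M S"
proof -
  obtain x where "x \<in> S" using assms(4) by blast
  then have "\<not> fun_space.dependent {col x}"
    using col_nonzero assms by (auto simp: fun_space.dependent_single)
  from rank_ge[OF assms(3) this] \<open>x \<in> S\<close> show ?thesis by (simp add: fun_space.span_base)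
qed

text \<open>Two distinct nonzero vectors are independent over GF(2), whose only scalars are 0 and
  1.\<close>

lemma rank_ge_2:
  assumes "connected_graph G" "card V > 1" "S \<subseteq> W" "2 \<le> card S"
    and "\<not> (\<exists>v w. pendant_on G v w)" "\<not> (\<exists>v w. twins G v w)"
  shows "2 \<le> rank_of M S"
proof -
  obtain T where "T \<subseteq> S" "card T = 2" using assms(4) obtain_subset_with_card_n by metis
  then obtain x y where xy: "x \<in> S" "y \<in> S" "x \<noteq> y" by (auto simp: card_2_iff)
  then have neq: "col x \<noteq> col y"
    using equal_columns_pendant_or_twins assms by blast
  have nz: "col x \<noteq> 0" "col y \<noteq> 0" using col_nonzero assms xy by auto
  have "col x \<notin> fun_space.span {col y}"
  proof
    assume "col x \<in> fun_space.span {col y}"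
    then obtain c where c: "col x = fun_scale c (col y)"
      by (auto simp: fun_space.span_singleton)
    show False using c neq nz(1) by (cases c) (auto simp: fun_eq_iff)
  qed
  moreover have "\<not> fun_space.dependent {col y}"
    using nz(2) by (simp add: fun_space.dependent_single)
  ultimately have "\<not> fun_space.dependent {col x, col y}"
    by (rule fun_space.independent_insertI)
  from rank_ge[OF assms(3) this] xy neq show ?thesis by (simp add: fun_space.span_base)
qed

lemma connectivity_pos:
  assumes "connected_graph G" "card V > 1" "S \<subseteq> W" "S \<noteq> {}" "W - S \<noteq> {}"
  shows "1 \<le> connectivity M S"
  using connectivity_cases[OF assms(1,3)] rank_pos[OF assms(1-4)]
    rank_pos[OF assms(1,2) _ assms(5)] by auto

lemma connectivity_ge_2:
  assumes "connected_graph G" "card V > 1" "S \<subseteq> W" "2 \<le> card S" "2 \<le> card (W - S)"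
    and "\<not> (\<exists>v w. pendant_on G v w)" "\<not> (\<exists>v w. twins G v w)"
  shows "2 \<le> connectivity M S"
  using connectivity_cases[OF assms(1,3)] rank_ge_2[OF assms(1-4,6,7)]
    rank_ge_2[OF assms(1,2) _ assms(5-7)] by auto

lemma dependent_nonempty: "dependent_set M S \<Longrightarrow> S \<noteq> {}"
  by (auto simp: dependent_set_def indep_iff fun_space.independent_empty)

text \<open>A dependent set with one element would be a zero column.\<close>

lemma dependent_card_ge_2:
  assumes "connected_graph G" "card V > 1" "dependent_set M S"
  shows "2 \<le> card S"
proof (rule ccontr)
  assume "\<not> 2 \<le> card S"
  moreover have SW: "S \<subseteq> W" using assms(3) by (simp add: dependent_set_def)
  moreover have "card S \<noteq> 0"
    using dependent_nonempty[OF assms(3)] finite_subset[OF SW] by simp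
  ultimately have "card S = 1" by linarith
  then obtain x where x: "S = {x}" by (auto simp: card_1_singleton_iff)
  then have "\<not> fun_space.dependent (col ` S)"
    using col_nonzero assms(1,2) SW
    by (simp add: fun_space.dependent_single)
  with x assms(3) show False by (auto simp: dependent_set_def indep_iff)
qed

lemma separation_ge_1:
  assumes "ordinary_separation M k S \<or> cyclic_separation M k S"
  shows "1 \<le> k"
  using assms connectivity_nonneg[of S]
  by (auto simp: ordinary_separation_def cyclic_separation_def)

text \<open>For ordinary separations, the bound 1 \<le> k already makes both sides nonempty; for
  cyclic ones, dependence does.\<close>

lemma separation_ge_2:
  assumes "connected_graph G" "card V > 1" "ordinary_separation M k S \<or> cyclic_separation M k S"
  shows "2 \<le> k"
proof -
  have "S \<noteq> {} \<and> W - S \<noteq> {}"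
    using assms(3)
  proof
    assume o: "ordinary_separation M k S"
    then have "1 \<le> card S" "1 \<le> card (W - S)"
      using separation_ge_1[of k S] by (auto simp: ordinary_separation_def)
    then show ?thesis by (metis card.empty not_one_le_zero)
  next
    assume "cyclic_separation M k S"
    then show ?thesis by (auto simp: cyclic_separation_def dest: dependent_nonempty)
  qed
  moreover have "S \<subseteq> W" "connectivity M S < int k"
    using assms(3) by (auto simp: ordinary_separation_def cyclic_separation_def)
  ultimately show ?thesis using connectivity_pos[OF assms(1,2), of S] by linarith
qed

text \<open>The same bootstrapping one level up: both sides have two elements, by 2 \<le> k or by
  dependence, and this is what the sharper connectivity bound asks for.\<close>

lemma separation_ge_3:
  assumes G: "connected_graph G" "card V > 1"
    and nopt: "\<not> (\<exists>v w. pendant_on G v w)" "\<not> (\<exists>v w. twins G v w)"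
    and sep: "ordinary_separation M k S \<or> cyclic_separation M k S"
  shows "3 \<le> k"
proof -
  have "2 \<le> card S \<and> 2 \<le> card (W - S)"
    using sep separation_ge_2[OF G sep] dependent_card_ge_2[OF G]
    by (auto simp: ordinary_separation_def cyclic_separation_def)
  moreover have "S \<subseteq> W" "connectivity M S < int k"
    using sep by (auto simp: ordinary_separation_def cyclic_separation_def)
  ultimately show ?thesis using connectivity_ge_2[OF G _ _ _ nopt, of S] by linarith
qed

section \<open>The values of \<open>tau\<close> and \<open>kappa_star\<close> in the four
  cases\<close>

lemma tau_kappa_eqI:
  assumes "ordinary_separation M k S" "cyclic_separation M k S" "k \<le> 2 * card V"
    and "\<And>j T. ordinary_separation M j T \<or> cyclic_separation M j T \<Longrightarrow> k \<le> j"
  shows "tau M = enat k \<and> kappa_star M = k"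
proof
  show "tau M = enat k" using assms(4) by (intro tau_eqI[OF assms(1)]) blast
  show "kappa_star M = k"
    \<comment> \<open>The default value in \<open>kappa_star\<close> is 3n - n = 2n for n vertices,
      hence the bound on \<open>k\<close>.\<close>
    using assms(3,4) by (intro kappa_star_eqI[OF assms(2)]) (auto simp: card_W matroid_rank_M)
qed

lemma tau_kappa_empty:
  assumes "V = {}"
  shows "tau M = \<infinity> \<and> kappa_star M = 0"
proof -
  have "\<not> ordinary_separation M k S" for k S
  proof
    assume o: "ordinary_separation M k S"
    then have "k \<le> card S" "S \<subseteq> W" by (auto simp: ordinary_separation_def)
    \<comment> \<open>Only \<open>k = 0\<close> fits into an empty ground set, and this would
      require negative connectivity.\<close>
    with assms have "k = 0" by (simp add: isotropic_ground_def)
    with o separation_ge_1[of k S] show False by simp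
  qed
  moreover have "card W - matroid_rank M = 0" using assms by (simp add: card_W)
  ultimately show ?thesis
    by (auto simp: tau_def kappa_star_def Inf_nat_def top_enat_def intro: Least_eq_0)
qed

lemma tau_kappa_singleton:
  assumes "card V = 1"
  shows "tau M = 1 \<and> kappa_star M = 1"
proof -
  obtain v where v: "V = {v}" using assms by (auto simp: card_1_singleton_iff)
  \<comment> \<open>The vertex is isolated, so diagonal entry 0 makes the column zero. This is
    \<open>Chi v\<close> if \<open>v\<close> is unlooped and \<open>Psi v\<close> if it is
    looped.\<close>
  obtain x where x: "x = Chi v \<or> x = Psi v" "col x = (\<lambda>u. if u = v then 0 else of_bool (u \<in> N v))"
    using obtain_column[of v] v by blast
  have "N v = {}" using neighbor_in_V[of _ v] v by (metis not_self_neighbor singletonD equals0I)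
  then have zero: "col x = 0" using x(2) by (auto simp: fun_eq_iff)
  have xW: "{x} \<subseteq> W" using x(1) v by auto
  have "rank_of M {x} \<le> card ({} :: 'v set)"
    by (rule rank_le_support) (use xW zero in auto)
  moreover have "rank_of M (W - {x}) \<le> 1" using rank_le_card_V[of "W - {x}"] assms by auto
  ultimately have conn: "connectivity M {x} < 1"
    by (simp add: connectivity_def matroid_rank_M assms)
  have card: "card (W - {x}) = 2" using xW assms by (simp add: card_W)
  have "dependent_set M {x}"
    using xW zero by (simp add: dependent_set_def indep_iff fun_space.dependent_zero)
  moreover have "dependent_set M (W - {x})" using card assms by (intro dependent_of_card) auto
  ultimately have "cyclic_separation M 1 {x}" "ordinary_separation M 1 {x}"
    using xW conn card by (auto simp: cyclic_separation_def ordinary_separation_def)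
  from tau_kappa_eqI[OF this(2,1)] assms separation_ge_1 show ?thesis by (simp add: one_enat_def)
qed

text \<open>The elements over a component have columns supported on it, and the remaining columns
  are supported on the other vertices. So the two ranks add up to at most the rank of
  \<open>M\<close>.\<close>

lemma tau_kappa_disconnected:
  assumes "\<not> connected_graph G"
  shows "tau M = 1 \<and> kappa_star M = 1"
proof -
  obtain a b where ab: "a \<in> V" "b \<in> V" "\<not> (\<lambda>x y. y \<in> N x)\<^sup>*\<^sup>* a b"
    using assms by (auto simp: connected_graph_def)
  define X where "X = {w \<in> V. (\<lambda>x y. y \<in> N x)\<^sup>*\<^sup>* a w}"
  have X: "X \<subseteq> V" "a \<in> X" "b \<in> V - X" using ab by (auto simp: X_def)
  have closed: "w \<in> X" if "v \<in> X" "w \<in> N v" for v w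
    using that neighbor_in_V by (auto simp: X_def intro: rtranclp.rtrancl_into_rtrancl)
  define S where "S = Phi ` X \<union> Chi ` X \<union> Psi ` X"
  have SW: "S \<subseteq> W" using X by (auto simp: S_def)
  have compl: "W - S = Phi ` (V - X) \<union> Chi ` (V - X) \<union> Psi ` (V - X)"
    by (auto simp: S_def isotropic_ground_def)
  have "rank_of M S \<le> card X"
  proof (rule rank_le_support[OF SW X(1)])
    fix x u assume x: "x \<in> S" and u: "u \<in> V - X"
    then consider v where "v \<in> X" "x = Phi v" | v where "v \<in> X" "x = Chi v \<or> x = Psi v"
      by (auto simp: S_def)
    then show "col x u = 0"
    proof cases
      case (1 v)
      then show ?thesis using u X(1) by (auto simp: col_Phi subset_iff)
    next
      case (2 v)
      then have "u \<noteq> v" "u \<notin> N v" using u closed by auto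
      then show ?thesis using col_off_diagonal[OF 2(2)] by simp
    qed
  qed
  moreover have "rank_of M (W - S) \<le> card (V - X)"
  proof (rule rank_le_support)
    fix x u assume x: "x \<in> W - S" and u: "u \<in> V - (V - X)"
    then consider v where "v \<in> V - X" "x = Phi v" | v where "v \<in> V - X" "x = Chi v \<or> x = Psi v"
      unfolding compl by blast
    then show "col x u = 0"
    proof cases
      case (1 v)
      then show ?thesis using u by (auto simp: col_Phi)
    next
      case (2 v)
      then have "u \<noteq> v" "u \<notin> N v" using u closed neighbor_sym by blast+
      then show ?thesis using col_off_diagonal[OF 2(2)] by simp
    qed
  qed auto
  moreover have "card X + card (V - X) = card V"
    using card_mono[of V X] X finite_subset[OF X(1)] by (simp add: card_Diff_subset)
  ultimately have conn: "connectivity M S < 1"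
    by (simp add: connectivity_def matroid_rank_M)
  have dep: "dependent_set M S" "dependent_set M (W - S)"
  proof -
    \<comment> \<open>\<open>S\<close> contains all three elements over \<open>a\<close>, and its
      complement all three over \<open>b\<close>.\<close>
    show "dependent_set M S"
      using SW X by (intro dependent_of_triple[of _ a]) (auto simp: S_def)
    show "dependent_set M (W - S)"
      using X(3) by (intro dependent_of_triple[of _ b]) (simp_all add: S_def image_iff)
  qed
  then have "1 \<le> card S" "1 \<le> card (W - S)"
    using dependent_nonempty[OF dep(1)] dependent_nonempty[OF dep(2)] finite_subset[OF SW]
    by (simp_all add: Suc_le_eq card_gt_0_iff)
  then have "cyclic_separation M 1 S" "ordinary_separation M 1 S"
    using SW conn dep by (auto simp: cyclic_separation_def ordinary_separation_def)
  moreover have "0 < card V" using ab(1) by (auto simp: card_gt_0_iff)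
  ultimately show ?thesis
    using tau_kappa_eqI[of 1 S] separation_ge_1 by (simp add: one_enat_def)
qed

text \<open>A pair of equal columns has rank at most 1, so its connectivity is at most 1.\<close>

lemma tau_kappa_pendant_or_twins:
  assumes G: "connected_graph G" "card V > 1"
    and "(\<exists>v w. pendant_on G v w) \<or> (\<exists>v w. twins G v w)"
  shows "tau M = 2 \<and> kappa_star M = 2"
proof -
  obtain x y where xy: "x \<in> W" "y \<in> W" "x \<noteq> y" "col x = col y"
    using obtain_equal_columns assms(3) by blast
  let ?S = "{x, y}"
  have SW: "?S \<subseteq> W" using xy by simp
  have "rank_of M ?S \<le> card {col x}"
    using xy SW by (intro rank_le) (auto simp: fun_space.span_base)
  moreover have "rank_of M (W - ?S) \<le> card V" by (rule rank_le_card_V) auto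
  ultimately have conn: "connectivity M ?S < 2"
    by (simp add: connectivity_def matroid_rank_M)
  have card: "card ?S = 2" "card (W - ?S) = 3 * card V - 2"
    using xy SW by (simp_all add: card_Diff_subset card_W)
  have "dependent_set M ?S"
    using xy by (auto simp: dependent_set_def indep_iff)
  \<comment> \<open>For n > 1 the 3n - 2 remaining elements outnumber the rank n.\<close>
  moreover have "dependent_set M (W - ?S)" using card G(2) by (intro dependent_of_card) auto
  ultimately have "cyclic_separation M 2 ?S" "ordinary_separation M 2 ?S"
    using SW conn card G(2) by (auto simp: cyclic_separation_def ordinary_separation_def)
  from tau_kappa_eqI[OF this(2,1)] G separation_ge_2 show ?thesis by (simp add: numeral_eq_enat)
qed

text \<open>The triple over any vertex is dependent of rank at most 2, so its connectivity is at
  most 2; for n > 1 the other 3n - 3 elements still outnumber the rank n.\<close>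

lemma tau_kappa_no_pendant_no_twins:
  assumes G: "connected_graph G" "card V > 1"
    and nopt: "\<not> (\<exists>v w. pendant_on G v w)" "\<not> (\<exists>v w. twins G v w)"
  shows "tau M = 3 \<and> kappa_star M = 3"
proof -
  obtain v where v: "v \<in> V" using G(2) by fastforce
  let ?S = "{Phi v, Chi v, Psi v}"
  have SW: "?S \<subseteq> W" using v by simp
  have "col (Psi v) \<in> fun_space.span {col (Phi v), col (Chi v)}"
    unfolding col_Psi by (intro fun_space.span_add fun_space.span_base) auto
  then have "rank_of M ?S \<le> card {col (Phi v), col (Chi v)}"
    using SW by (intro rank_le) (auto simp: fun_space.span_base)
  also have "\<dots> \<le> 2" by (simp add: card_insert_if)
  finally have "rank_of M ?S \<le> 2" .
  moreover have "rank_of M (W - ?S) \<le> card V" by (rule rank_le_card_V) auto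
  ultimately have conn: "connectivity M ?S < 3"
    by (simp add: connectivity_def matroid_rank_M)
  have card: "card ?S = 3" "card (W - ?S) = 3 * card V - 3"
    using SW by (simp_all add: card_Diff_subset card_W)
  have "dependent_set M ?S"
    using v by (intro dependent_of_triple[of _ v]) auto
  moreover have "dependent_set M (W - ?S)" using card G(2) by (intro dependent_of_card) auto
  ultimately have "cyclic_separation M 3 ?S" "ordinary_separation M 3 ?S"
    using SW conn card G(2) by (auto simp: cyclic_separation_def ordinary_separation_def)
  from tau_kappa_eqI[OF this(2,1)] G separation_ge_3[OF G nopt] show ?thesis
    by (simp add: numeral_eq_enat)
qed

end

theorem theorem1:
  fixes G :: "'v graph" and n :: nat and M :: "'v isotropic_elt matroid"
  assumes "looped_simple_graph G"
    and "n = card (verts G)"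
    and "M = isotropic_matroid G"
  shows
    "(\<exists>!i::nat.
        (i = 1 \<and> n = 0) \<or>
        (i = 2 \<and> (n = 1 \<or> \<not> connected_graph G)) \<or>
        (i = 3 \<and> n > 1 \<and> connected_graph G \<and>
           ((\<exists>v w. pendant_on G v w) \<or> (\<exists>v w. twins G v w))) \<or>
        (i = 4 \<and> n > 1 \<and> connected_graph G \<and>
           \<not> (\<exists>v w. pendant_on G v w) \<and> \<not> (\<exists>v w. twins G v w))) \<and>
     (n = 0 \<longrightarrow> kappa_star M = 0 \<and> tau M = \<infinity>) \<and>
     (n = 1 \<or> \<not> connected_graph G \<longrightarrow> tau M = 1 \<and> kappa_star M = 1) \<and>
     (n > 1 \<and> connected_graph G \<and>
        ((\<exists>v w. pendant_on G v w) \<or> (\<exists>v w. twins G v w)) \<longrightarrow>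
        tau M = 2 \<and> kappa_star M = 2) \<and>
     (n > 1 \<and> connected_graph G \<and>
        \<not> (\<exists>v w. pendant_on G v w) \<and> \<not> (\<exists>v w. twins G v w) \<longrightarrow>
        tau M = 3 \<and> kappa_star M = 3)"
proof -
  interpret isotropic G using assms(1) by unfold_locales
  \<comment> \<open>The empty graph is vacuously connected, which keeps it out of the second
    case.\<close>
  have zero: "connected_graph G \<and> verts G = {}" if "n = 0"
    using that assms(2) by (simp add: connected_graph_def)
  let ?P = "(\<exists>v w. pendant_on G v w) \<or> (\<exists>v w. twins G v w)"
  consider "n = 0" "connected_graph G" | "n = 1 \<or> \<not> connected_graph G" "n \<noteq> 0"
    | "n > 1" "connected_graph G" ?P | "n > 1" "connected_graph G" "\<not> ?P"
    using zero by (cases "n = 0"; cases "n = 1") auto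
  then show ?thesis
  proof cases
    case 1
    moreover have "tau M = \<infinity> \<and> kappa_star M = 0"
      using 1 tau_kappa_empty zero assms(3) by simp
    ultimately show ?thesis by simp
  next
    case 2
    moreover have "tau M = 1 \<and> kappa_star M = 1"
      using 2(1) tau_kappa_singleton tau_kappa_disconnected assms(2,3) by metis
    ultimately show ?thesis by auto
  next
    case 3
    moreover have "tau M = 2 \<and> kappa_star M = 2"
      using 3 tau_kappa_pendant_or_twins assms(2,3) by simp
    ultimately show ?thesis by auto
  next
    case 4
    moreover have "tau M = 3 \<and> kappa_star M = 3"
      using 4 tau_kappa_no_pendant_no_twins assms(2,3) by simp
    ultimately show ?thesis by auto
  qed
qed

end
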